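(* Let $w\in\mathfrak S_n$ be a skew-vexillary permutation, let $S_{\lambda/\mu(w)}\subseteq[n]\times[n]$ be a skew shape whose complement is obtained from the Rothe diagram $R_w$ by permuting rows and columns, and let $0\le r\le n$. Then, for every prime power $q$, $$\frac{\mathrm{mat}_q(n,R_w,r)}{(q-1)^r}=q^{n^2-\mathrm{inv}(w)-r}\,R_r^{(\mathrm{NE})}(S_{\lambda/\mu(w)},q^{-1}),$$ and this is a polynomial in $q$ with nonnegative integer coefficients.
   Context: $[n]=\{1,\dots,n\}$; $\mathfrak S_n$ is the group of permutations of $[n]$; $\mathrm{inv}(w)=\#\{(i,j)\mid i<j,\ w_i>w_j\}$. Positions in $[n]\times[n]$ are in matrix coordinates (row, column), rows numbered north to south and columns west to east. The Rothe diagram is $R_w=\{(i,j)\mid 1\le i,j\le n,\ w(i)>j,\ w^{-1}(j)>i\}$. For a partition $\lambda$, given by integers $n\ge\lambda_1\ge\cdots\ge\lambda_n\ge0$, $S_\lambda=\{(i,j)\mid 1\le i\le n,\ 1\le j\le\lambda_i\}$; a skew shape is a set $S_{\lambda/\mu}=S_\lambda\setminus S_\mu$ with $S_\mu\subseteq S_\lambda$. The permutation $w$ is skew-vexillary if there are $\sigma,\tau\in\mathfrak S_n$ and a skew shape $S_{\lambda/\mu}$ with $\{(\sigma(i),\tau(j))\mid(i,j)\in R_w\}=([n]\times[n])\setminus S_{\lambda/\mu}$; such a skew shape is denoted $S_{\lambda/\mu(w)}$. For $S\subseteq[n]\times[n]$, $\mathrm{mat}_q(n,S,r)$ is the number of $n\times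 n$ matrices $A=(a_{ij})$ over the field $\mathbf F_q$ with $q$ elements of rank $r$ with $a_{ij}=0$ whenever $(i,j)\in S$. For $B\subseteq[n]\times[n]$, a placement $C$ of $r$ non-attacking rooks on $B$ is a set of $r$ positions of $B$, no two in the same row or column; $\mathrm{inv}_{\mathrm{NE}}(C,B)$ is the number of elements of $B$ not occupied by a rook of $C$ and not directly north of (same column) or directly east of (same row) any rook of $C$; and $R_r^{(\mathrm{NE})}(B,q)=\sum_Cq^{\mathrm{inv}_{\mathrm{NE}}(C,B)}$ over all such placements $C$. *)

theory Defs
  imports
    "Jordan_Normal_Form.DL_Rank"
    "HOL-Library.Cardinality"
    "HOL-Number_Theory.Prime_Powers"
    "HOL-Combinatorics.Permutations"
begin

text \<open>
  A position is a pair (row, column) in \<open>{1..n} \<times> {1..n}\<close>, in matrix coordinates: rows are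
  numbered from north to south and columns from west to east, so north means a smaller first
  component and east a larger second one.
\<close>

definition grid :: "nat \<Rightarrow> (nat \<times> nat) set" where
  "grid n = {1..n} \<times> {1..n}"

definition num_inversions :: "nat \<Rightarrow> (nat \<Rightarrow> nat) \<Rightarrow> nat" where
  "num_inversions n w = card {(i, j). i \<in> {1..n} \<and> j \<in> {1..n} \<and> i < j \<and> w i > w j}"

definition rothe_diagram :: "nat \<Rightarrow> (nat \<Rightarrow> nat) \<Rightarrow> (nat \<times> nat) set" where
  "rothe_diagram n w = {(i, j) \<in> grid n. w i > j \<and> Hilbert_Choice.inv w j > i}"

text \<open>Partitions are functions of which only the values at \<open>1, \<dots>, n\<close> matter.\<close>

definition is_partition :: "nat \<Rightarrow> (nat \<Rightarrow> nat) \<Rightarrow> bool" where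
  "is_partition n lam \<longleftrightarrow>
     (\<forall>i\<in>{1..n}. lam i \<le> n) \<and> (\<forall>i\<in>{1..n}. \<forall>j\<in>{1..n}. i \<le> j \<longrightarrow> lam j \<le> lam i)"

definition straight_shape :: "nat \<Rightarrow> (nat \<Rightarrow> nat) \<Rightarrow> (nat \<times> nat) set" where
  "straight_shape n lam = {(i, j). 1 \<le> i \<and> i \<le> n \<and> 1 \<le> j \<and> j \<le> lam i}"

definition is_skew_shape :: "nat \<Rightarrow> (nat \<times> nat) set \<Rightarrow> bool" where
  "is_skew_shape n S \<longleftrightarrow>
     (\<exists>lam mu. is_partition n lam \<and> is_partition n mu \<and>
        straight_shape n mu \<subseteq> straight_shape n lam \<and>
        S = straight_shape n lam - straight_shape n mu)"

definition skew_shape_of_perm :: "nat \<Rightarrow> (nat \<Rightarrow> nat) \<Rightarrow> (nat \<times> nat) set \<Rightarrow> bool" where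
  "skew_shape_of_perm n w S \<longleftrightarrow>
     is_skew_shape n S \<and>
     (\<exists>\<sigma> \<tau>. \<sigma> permutes {1..n} \<and> \<tau> permutes {1..n} \<and>
        {(\<sigma> i, \<tau> j) | i j. (i, j) \<in> rothe_diagram n w} = grid n - S)"

definition skew_vexillary :: "nat \<Rightarrow> (nat \<Rightarrow> nat) \<Rightarrow> bool" where
  "skew_vexillary n w \<longleftrightarrow> w permutes {1..n} \<and> (\<exists>S. skew_shape_of_perm n w S)"

text \<open>
  The field with \<open>q\<close> elements is a type \<open>'a\<close> with \<open>CARD('a) = q\<close>. Matrix entries are indexed
  from 0 in the library, whence the shift by one.
\<close>

definition mat_count ::
    "'a::{field,finite} itself \<Rightarrow> nat \<Rightarrow> (nat \<times> nat) set \<Rightarrow> nat \<Rightarrow> nat" where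
  "mat_count TYPE('a) n S r =
     card {A :: 'a mat. A \<in> carrier_mat n n \<and> vec_space.rank n A = r \<and>
             (\<forall>(i, j)\<in>S. A $$ (i - 1, j - 1) = 0)}"

definition is_rook_placement ::
    "nat \<Rightarrow> (nat \<times> nat) set \<Rightarrow> (nat \<times> nat) set \<Rightarrow> bool" where
  "is_rook_placement r B C \<longleftrightarrow>
     C \<subseteq> B \<and> finite C \<and> card C = r \<and> inj_on fst C \<and> inj_on snd C"

definition inv_NE :: "(nat \<times> nat) set \<Rightarrow> (nat \<times> nat) set \<Rightarrow> nat" where
  "inv_NE C B =
     card {(i, j) \<in> B. (i, j) \<notin> C \<and>
             \<not> (\<exists>k. (k, j) \<in> C \<and> i < k) \<and> \<not> (\<exists>l. (i, l) \<in> C \<and> l < j)}"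

definition rook_poly_NE :: "nat \<Rightarrow> (nat \<times> nat) set \<Rightarrow> real \<Rightarrow> real" where
  "rook_poly_NE r B q = (\<Sum>C | is_rook_placement r B C. q ^ inv_NE C B)"

end

theory Submission
  imports Defs "Jordan_Normal_Form.Matrix_Kernel"
begin

text \<open>
  Gaussian elimination turns the count of matrices into a sum over rook placements. Permuting
  rows and columns changes no rank, so the matrices vanishing on the Rothe diagram may be replaced
  by those supported in the skew shape \<open>S\<close>. A skew shape is closed under completing north-east
  corners (\<open>NE_closed\<close>): if \<open>(i, j)\<close>, a position
  \<open>(i', j)\<close> north of it and a position \<open>(i, j')\<close> east of it lie in \<open>S\<close>, so does \<open>(i', j')\<close>.
  Unlike being a skew shape, this property survives the deletion of rows and columns, which is
  what makes an induction possible.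

  Take a matrix \<open>A\<close> supported in such a board \<open>B\<close>, look at its bottom row \<open>p\<close> and let \<open>(p, j)\<close> be
  the leftmost nonzero entry there. Subtracting the rank one matrix
  \<open>A(i, j) A(p, k) / A(p, j)\<close> clears row \<open>p\<close> and column \<open>j\<close>, lowers the rank by exactly one
  (\<open>array_rank_schur_complement\<close>), and leaves the support inside \<open>B\<close> because of the corner
  condition. Conversely \<open>A\<close> is recovered from the cleared matrix together with the pivot, the
  entries of \<open>B\<close> east of the pivot and those north of it, all of which can be chosen freely apart
  from the pivot being nonzero. Over \<open>q\<close> elements this gives a factor \<open>(q - 1) q\<^sup>h\<close>, with \<open>h\<close> the
  number of positions of \<open>B\<close> north or east of the pivot (\<open>card_arrays_with_pivot\<close>).

  Placing rooks on \<open>B\<close> row by row from the bottom obeys the same recursion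
  (\<open>dominated_sum_Suc\<close>): a rook at \<open>(p, j)\<close> is responsible for precisely those \<open>h\<close> positions, and
  the remaining rooks live on \<open>B\<close> without row \<open>p\<close> and column \<open>j\<close>. So the number of matrices of
  rank \<open>r\<close> is \<open>(q - 1)\<^sup>r\<close> times the sum of \<open>q\<^sup>d\<close> over all placements, where \<open>d\<close> counts the
  unoccupied positions north or east of a rook (\<open>card_arrays_of_rank\<close>). As \<open>d\<close> and the statistic
  of the north-east rook polynomial add up to \<open>card S - r\<close>, and \<open>card S = n\<^sup>2 - inv(w)\<close>, this sum
  is the right-hand side of the claim; read as a polynomial in \<open>q\<close>, its coefficients are
  evidently nonnegative integers.

  Rank is handled through the size of the kernel, which is \<open>q\<close> to the power \<open>n - r\<close>: to compare
  two ranks it then suffices to exhibit a bijection between kernels.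
\<close>

section \<open>Rank and the size of the kernel\<close>

text \<open>
  Coordinates with respect to a basis identify the space with the functions from the basis to the
  scalars.
\<close>

lemma (in vectorspace) card_carrier_eq_power_dim:
  assumes "fin_dim"
  shows "card (carrier V) = card (carrier K) ^ dim"
proof -
  obtain B where B: "finite B" "basis B"
    using assms finite_basis_exists by blast
  have sub: "B \<subseteq> carrier V"
    using B(2) by (simp add: basis_def)
  have "bij_betw (\<lambda>a. lincomb a B) (B \<rightarrow>\<^sub>E carrier K) (carrier V)"
    unfolding bij_betw_def
  proof
    have closed: "lincomb a B \<in> carrier V" if "a \<in> B \<rightarrow>\<^sub>E carrier K" for a
      using that sub by (intro lincomb_closed) auto
    have ex1: "\<exists>!a. a \<in> B \<rightarrow>\<^sub>E carrier K \<and> lincomb a B = v" if "v \<in> carrier V" for v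
      using basis_criterion[OF B(1) sub] B(2) that by blast
    show "inj_on (\<lambda>a. lincomb a B) (B \<rightarrow>\<^sub>E carrier K)"
    proof (rule inj_onI)
      fix a b
      assume "a \<in> B \<rightarrow>\<^sub>E carrier K" "b \<in> B \<rightarrow>\<^sub>E carrier K" "lincomb a B = lincomb b B"
      then show "a = b"
        using ex1[OF closed, of b] by blast
    qed
    show "(\<lambda>a. lincomb a B) ` (B \<rightarrow>\<^sub>E carrier K) = carrier V"
      using closed ex1 by blast
  qed
  then have "card (carrier V) = card (B \<rightarrow>\<^sub>E carrier K)"
    by (simp add: bij_betw_same_card)
  also have "\<dots> = card (carrier K) ^ card B"
    by (simp add: card_PiE B(1))
  also have "card B = dim"
    using dim_basis[OF B] by simp
  finally show ?thesis .
qed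

lemma card_carrier_vec:
  "card (carrier_vec n :: 'a::{field,finite} vec set) = CARD('a) ^ n"
proof -
  interpret vec_space "TYPE('a)" n .
  show ?thesis
    using card_carrier_eq_power_dim[OF fin_dim] by (simp add: dim_is_n)
qed

lemma finite_carrier_vec:
  "finite (carrier_vec n :: 'a::{field,finite} vec set)"
  by (rule card_ge_0_finite) (simp add: card_carrier_vec)

text \<open>
  The image of \<open>A\<close> is its column space, whose dimension is by definition the rank.
\<close>

lemma card_image_mult_mat_vec:
  fixes A :: "'a::{field,finite} mat"
  assumes A: "A \<in> carrier_mat n nc"
  shows "card ((*\<^sub>v) A ` carrier_vec nc) = CARD('a) ^ vec_space.rank n A"
proof -
  interpret vec_space "TYPE('a)" n .
  have sub: "set (cols A) \<subseteq> carrier_vec n"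
    using A cols_dim by blast
  interpret W: vectorspace class_ring "span_vs (set (cols A))"
    using span_is_subspace[OF sub[folded module_vec_simps(3)]] subspace_is_vs by blast
  have "W.fin_dim"
    using fin_dim_span_cols[OF A] by simp
  from W.card_carrier_eq_power_dim[OF this]
  have "card (span (set (cols A))) = CARD('a) ^ rank A"
    by (simp add: rank_def)
  moreover have "span (set (cols A)) = (*\<^sub>v) A ` carrier_vec nc"
    using col_space_eq[OF A] A by (auto simp: col_space_def)
  ultimately show ?thesis by simp
qed

text \<open>
  Every nonempty fibre of \<open>x \<mapsto> A x\<close> is a translate of the kernel, so the kernel and the image
  multiply up to the whole space.
\<close>

lemma card_mat_kernel:
  fixes A :: "'a::{field,finite} mat"
  assumes A: "A \<in> carrier_mat n nc"
  shows "card (mat_kernel A) = CARD('a) ^ (nc - vec_space.rank n A)"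
proof -
  let ?q = "CARD('a)" and ?r = "vec_space.rank n A" and ?V = "carrier_vec nc :: 'a vec set"
  have fibre: "card {x \<in> ?V. A *\<^sub>v x = A *\<^sub>v x0} = card (mat_kernel A)" if x0: "x0 \<in> ?V" for x0
  proof -
    have "bij_betw (\<lambda>x. x + x0) (mat_kernel A) {x \<in> ?V. A *\<^sub>v x = A *\<^sub>v x0}"
    proof (rule bij_betw_byWitness[where f' = "\<lambda>x. x - x0"])
      show "\<forall>x\<in>mat_kernel A. x + x0 - x0 = x"
        using x0 by (auto simp: mat_kernel[OF A] intro!: eq_vecI)
      show "\<forall>x\<in>{x \<in> ?V. A *\<^sub>v x = A *\<^sub>v x0}. x - x0 + x0 = x"
        using x0 by (auto intro!: eq_vecI)
      show "(\<lambda>x. x + x0) ` mat_kernel A \<subseteq> {x \<in> ?V. A *\<^sub>v x = A *\<^sub>v x0}"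
        using x0 A by (auto simp: mat_kernel[OF A] mult_add_distrib_mat_vec[OF A])
      show "(\<lambda>x. x - x0) ` {x \<in> ?V. A *\<^sub>v x = A *\<^sub>v x0} \<subseteq> mat_kernel A"
        using x0 A by (auto simp: mat_kernel[OF A] mult_minus_distrib_mat_vec[OF A])
    qed
    then show ?thesis
      by (simp add: bij_betw_same_card)
  qed
  have "?q ^ nc = card ?V"
    by (simp add: card_carrier_vec)
  also have "\<dots> = card (\<Union>y\<in>(*\<^sub>v) A ` ?V. {x \<in> ?V. A *\<^sub>v x = y})"
    by (rule arg_cong[of _ _ card]) auto
  also have "\<dots> = (\<Sum>y\<in>(*\<^sub>v) A ` ?V. card {x \<in> ?V. A *\<^sub>v x = y})"
    by (rule card_UN_disjoint) (auto simp: finite_carrier_vec)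
  also have "\<dots> = (\<Sum>y\<in>(*\<^sub>v) A ` ?V. card (mat_kernel A))"
    by (rule sum.cong) (use fibre in auto)
  also have "\<dots> = ?q ^ ?r * card (mat_kernel A)"
    by (simp add: card_image_mult_mat_vec[OF A])
  finally have "?q ^ ?r * card (mat_kernel A) = ?q ^ ?r * ?q ^ (nc - ?r)"
    using vec_space.rank_le_nc[OF A] by (simp flip: power_add)
  then show ?thesis by simp
qed

section \<open>Rank of arrays indexed by positions\<close>

text \<open>
  Matrices are treated as functions on all positions that vanish outside a board. Deleting a row or
  a column then means shrinking the board, with no change of matrix size; the shift by one passes
  from positions numbered from 1 to the matrix indices.
\<close>

definition array_mat :: "nat \<Rightarrow> (nat \<times> nat \<Rightarrow> 'a) \<Rightarrow> 'a mat" where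
  "array_mat n f = mat n n (\<lambda>(i, j). f (Suc i, Suc j))"

abbreviation array_rank :: "nat \<Rightarrow> (nat \<times> nat \<Rightarrow> 'a::field) \<Rightarrow> nat" where
  "array_rank n f \<equiv> vec_space.rank n (array_mat n f)"

text \<open>
  The kernel is kept in the same style: vectors vanish outside \<open>{1..n}\<close>, so that equal vectors are
  equal functions and the set is finite.
\<close>

definition array_kernel :: "nat \<Rightarrow> (nat \<times> nat \<Rightarrow> 'a::field) \<Rightarrow> (nat \<Rightarrow> 'a) set" where
  "array_kernel n f =
     {x. (\<forall>k. k \<notin> {1..n} \<longrightarrow> x k = 0) \<and> (\<forall>i\<in>{1..n}. (\<Sum>k\<in>{1..n}. f (i, k) * x k) = 0)}"

definition supported_in :: "'b set \<Rightarrow> ('b \<Rightarrow> 'a::zero) set" where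
  "supported_in B = {f. \<forall>x. x \<notin> B \<longrightarrow> f x = 0}"

lemma array_mat_carrier [simp]: "array_mat n f \<in> carrier_mat n n"
  by (simp add: array_mat_def)

lemma array_rank_le: "array_rank n f \<le> n"
  by (rule vec_space.rank_le_nc) simp

lemma card_array_kernel:
  fixes f :: "nat \<times> nat \<Rightarrow> 'a::{field,finite}"
  shows "card (array_kernel n f) = CARD('a) ^ (n - array_rank n f)"
proof -
  let ?to = "\<lambda>x::nat \<Rightarrow> 'a. vec n (\<lambda>k. x (Suc k))"
  let ?from = "\<lambda>v::'a vec. \<lambda>k. if k \<in> {1..n} then v $ (k - 1) else 0"
  have prod_eq: "row (array_mat n f) i \<bullet> v = (\<Sum>k\<in>{1..n}. f (Suc i, k) * v $ (k - 1))"
    if "i < n" "v \<in> carrier_vec n" for i v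
  proof -
    have "row (array_mat n f) i \<bullet> v = (\<Sum>k = 0..<n. f (Suc i, Suc k) * v $ k)"
      using that by (simp add: scalar_prod_def array_mat_def)
    also have "\<dots> = (\<Sum>k\<in>{1..n}. f (Suc i, k) * v $ (k - 1))"
      by (rule sum.reindex_bij_witness[of _ "\<lambda>k. k - 1" Suc]) auto
    finally show ?thesis .
  qed
  have mem: "v \<in> mat_kernel (array_mat n f) \<longleftrightarrow>
      v \<in> carrier_vec n \<and> (\<forall>i\<in>{1..n}. (\<Sum>k\<in>{1..n}. f (i, k) * v $ (k - 1)) = 0)" for v
  proof (cases "v \<in> carrier_vec n")
    case True
    have "array_mat n f *\<^sub>v v = 0\<^sub>v n \<longleftrightarrow>
        (\<forall>i<n. (\<Sum>k\<in>{1..n}. f (Suc i, k) * v $ (k - 1)) = 0)"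
      using True prod_eq[OF _ True] carrier_matD[OF array_mat_carrier[of n f]]
      by (auto simp: vec_eq_iff)
    also have "\<dots> \<longleftrightarrow> (\<forall>i\<in>{1..n}. (\<Sum>k\<in>{1..n}. f (i, k) * v $ (k - 1)) = 0)"
      unfolding image_Suc_lessThan[symmetric] by auto
    finally show ?thesis
      using True by (simp add: mat_kernel[OF array_mat_carrier])
  qed (simp add: mat_kernel[OF array_mat_carrier])
  have to_vec: "(\<Sum>k\<in>{1..n}. f (i, k) * ?to x $ (k - 1)) = (\<Sum>k\<in>{1..n}. f (i, k) * x k)" for i x
    by (rule sum.cong) auto
  have of_vec: "(\<Sum>k\<in>{1..n}. f (i, k) * ?from v k) = (\<Sum>k\<in>{1..n}. f (i, k) * v $ (k - 1))" for i v
    by (rule sum.cong) auto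
  have "bij_betw ?to (array_kernel n f) (mat_kernel (array_mat n f))"
  proof (rule bij_betw_byWitness[where f' = ?from])
    show "\<forall>x\<in>array_kernel n f. ?from (?to x) = x"
      by (auto simp: array_kernel_def fun_eq_iff)
    show "\<forall>v\<in>mat_kernel (array_mat n f). ?to (?from v) = v"
      by (auto simp: mem intro!: eq_vecI)
    show "?to ` array_kernel n f \<subseteq> mat_kernel (array_mat n f)"
      unfolding array_kernel_def by (auto simp only: mem to_vec mem_Collect_eq vec_carrier)
    show "?from ` mat_kernel (array_mat n f) \<subseteq> array_kernel n f"
      unfolding array_kernel_def by (auto simp only: mem of_vec mem_Collect_eq if_False)
  qed
  then show ?thesis
    by (simp add: bij_betw_same_card card_mat_kernel[OF array_mat_carrier])
qed

lemma two_le_card_field: "2 \<le> CARD('a::{field,finite})"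
proof -
  have "card {0, 1 :: 'a} \<le> CARD('a)"
    by (rule card_mono) auto
  then show ?thesis by simp
qed

lemma array_rank_eqI:
  fixes f g :: "nat \<times> nat \<Rightarrow> 'a::{field,finite}"
  assumes "card (array_kernel n f) = card (array_kernel n g)"
  shows "array_rank n f = array_rank n g"
proof -
  have "CARD('a) ^ (n - array_rank n f) = CARD('a) ^ (n - array_rank n g)"
    using assms unfolding card_array_kernel .
  then have "n - array_rank n f = n - array_rank n g"
    using two_le_card_field[where 'a = 'a] by (subst (asm) power_inject_exp) auto
  then show ?thesis
    using array_rank_le[of n f] array_rank_le[of n g] by simp
qed

text \<open>
  Composition with the column permutation is a bijection between the kernels; the row permutation
  only reorders the equations.
\<close>

lemma array_rank_permute:
  fixes f :: "nat \<times> nat \<Rightarrow> 'a::{field,finite}"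
  assumes s: "s permutes {1..n}" and t: "t permutes {1..n}"
  shows "array_rank n (\<lambda>(i, j). f (s i, t j)) = array_rank n f"
proof (rule array_rank_eqI, rule sym, rule bij_betw_same_card)
  have reidx: "(\<Sum>k\<in>{1..n}. f (s i, t k) * x (t k)) = (\<Sum>k\<in>{1..n}. f (s i, k) * x k)" for i x
    by (rule sum.permute[OF t, of "\<lambda>k. f (s i, k) * x k", unfolded comp_def, symmetric])
  have rows: "(\<forall>i\<in>{1..n}. P (s i)) \<longleftrightarrow> (\<forall>i\<in>{1..n}. P i)" for P
    by (subst (2) permutes_image[OF s, symmetric]) simp
  have kern: "x \<circ> t \<in> array_kernel n (\<lambda>(i, j). f (s i, t j)) \<longleftrightarrow> x \<in> array_kernel n f" for x
  proof -
    have "(\<forall>k. k \<notin> {1..n} \<longrightarrow> x (t k) = 0) \<longleftrightarrow> (\<forall>k. k \<notin> {1..n} \<longrightarrow> x k = 0)"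
      using permutes_not_in[OF t] by auto
    then show ?thesis
      unfolding array_kernel_def mem_Collect_eq comp_apply prod.case reidx
      by (simp only: rows[of "\<lambda>i. (\<Sum>k\<in>{1..n}. f (i, k) * x k) = 0"])
  qed
  show "bij_betw (\<lambda>x. x \<circ> t) (array_kernel n f) (array_kernel n (\<lambda>(i, j). f (s i, t j)))"
  proof (rule bij_betw_byWitness[where f' = "\<lambda>x. x \<circ> Hilbert_Choice.inv t"])
    show "(\<lambda>x. x \<circ> Hilbert_Choice.inv t) ` array_kernel n (\<lambda>(i, j). f (s i, t j)) \<subseteq> array_kernel n f"
    proof (rule image_subsetI)
      fix x assume "x \<in> array_kernel n (\<lambda>(i, j). f (s i, t j))"
      then show "x \<circ> Hilbert_Choice.inv t \<in> array_kernel n f"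
        using kern[of "x \<circ> Hilbert_Choice.inv t"] by (simp add: comp_assoc permutes_inv_o[OF t])
    qed
  qed (use kern in \<open>auto simp: comp_assoc permutes_inv_o[OF t]\<close>)
qed

text \<open>
  The kernel of the array \<open>g\<close> on the right is \<open>q\<close> times as large as that of \<open>f\<close>. Equation \<open>i\<close> of \<open>g\<close>
  is equation \<open>i\<close> of \<open>f\<close> minus a multiple of equation \<open>p\<close>, so passing from \<open>f\<close> to \<open>g\<close> just forgets
  equation \<open>p\<close>. Column \<open>j\<close> of \<open>g\<close> vanishes, so coordinate \<open>j\<close> of a solution can be shifted freely,
  and exactly one shift restores equation \<open>p\<close> because its coefficient there is nonzero.
\<close>

lemma array_rank_schur_complement:
  fixes f :: "nat \<times> nat \<Rightarrow> 'a::{field,finite}"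
  assumes p: "p \<in> {1..n}" and j: "j \<in> {1..n}" and pivot: "f (p, j) \<noteq> 0"
  shows "array_rank n f =
    Suc (array_rank n (\<lambda>(i, k). f (i, k) - f (i, j) * f (p, k) / f (p, j)))"
proof -
  define g where "g = (\<lambda>(i, k). f (i, k) - f (i, j) * f (p, k) / f (p, j))"
  let ?q = "CARD('a)"
  let ?dot = "\<lambda>i x. \<Sum>k\<in>{1..n}. f (i, k) * x k"
  have dot_upd: "?dot i (x(j := x j + t)) = ?dot i x + f (i, j) * t" for i x t
  proof -
    have "?dot i (x(j := x j + t)) =
        (\<Sum>k\<in>{1..n}. f (i, k) * x k + (if k = j then f (i, j) * t else 0))"
      by (rule sum.cong) (auto simp: algebra_simps)
    then show ?thesis
      using j by (simp add: sum.distrib)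
  qed
  have g_dot: "(\<Sum>k\<in>{1..n}. g (i, k) * x k) = ?dot i x - f (i, j) / f (p, j) * ?dot p x" for i x
    by (simp add: g_def sum_distrib_left sum_subtractf[symmetric] algebra_simps)
  let ?to = "\<lambda>(x, t). x(j := x j + t)"
  \<comment> \<open>the shift that makes equation \<open>p\<close> hold\<close>
  let ?from = "\<lambda>y. (y(j := y j + - (?dot p y / f (p, j))), ?dot p y / f (p, j))"
  have "bij_betw ?to (array_kernel n f \<times> (UNIV :: 'a set)) (array_kernel n g)"
  proof (rule bij_betw_byWitness[where f' = ?from])
    show "\<forall>a\<in>array_kernel n f \<times> (UNIV :: 'a set). ?from (?to a) = a"
    proof (rule ballI)
      fix a assume "a \<in> array_kernel n f \<times> (UNIV :: 'a set)"
      then obtain x t where a: "a = (x, t)" and "?dot p x = 0"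
        using p by (auto simp: array_kernel_def)
      then show "?from (?to a) = a"
        unfolding a prod.case dot_upd using pivot by simp
    qed
    show "\<forall>y\<in>array_kernel n g. ?to (?from y) = y"
      by simp
    show "?to ` (array_kernel n f \<times> (UNIV :: 'a set)) \<subseteq> array_kernel n g"
    proof (clarify)
      fix x t assume x: "x \<in> array_kernel n f"
      have z: "?dot i x = 0" if "i \<in> {1..n}" for i
        using x that by (simp add: array_kernel_def)
      have "(\<Sum>k\<in>{1..n}. g (i, k) * (x(j := x j + t)) k) = 0" if "i \<in> {1..n}" for i
        unfolding g_dot dot_upd z[OF that] z[OF p] using pivot by simp
      then show "x(j := x j + t) \<in> array_kernel n g"
        using x j by (auto simp: array_kernel_def)
    qed
    show "?from ` array_kernel n g \<subseteq> array_kernel n f \<times> (UNIV :: 'a set)"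
    proof (rule image_subsetI)
      fix y assume y: "y \<in> array_kernel n g"
      define t where "t = ?dot p y / f (p, j)"
      have "?dot i (y(j := y j + - t)) = 0" if "i \<in> {1..n}" for i
      proof -
        have "?dot i (y(j := y j + - t)) = (\<Sum>k\<in>{1..n}. g (i, k) * y k)"
          unfolding g_dot dot_upd t_def by simp
        also have "\<dots> = 0"
          using y that by (simp add: array_kernel_def)
        finally show ?thesis .
      qed
      then have "y(j := y j + - t) \<in> array_kernel n f"
        using y j by (auto simp: array_kernel_def)
      then show "?from y \<in> array_kernel n f \<times> (UNIV :: 'a set)"
        by (simp add: t_def)
    qed
  qed
  then have "card (array_kernel n g) = card (array_kernel n f) * ?q"
    by (simp add: bij_betw_same_card[symmetric] card_cartesian_product)
  then have "?q ^ (n - array_rank n g) = ?q ^ Suc (n - array_rank n f)"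
    by (simp add: card_array_kernel mult.commute)
  then have "n - array_rank n g = Suc (n - array_rank n f)"
    using two_le_card_field[where 'a = 'a] by (subst (asm) power_inject_exp) auto
  then show ?thesis
    using array_rank_le[of n f] array_rank_le[of n g] by (simp add: g_def)
qed

lemma array_rank_zero:
  fixes f :: "nat \<times> nat \<Rightarrow> 'a::field"
  shows "array_rank n (\<lambda>_. 0 :: 'a) = 0"
proof -
  have "array_mat n (\<lambda>_. 0 :: 'a) = 0\<^sub>m n n"
    by (auto simp: array_mat_def)
  then show ?thesis
    by (simp add: vec_space.rank_0I)
qed

lemma card_supported_in:
  assumes "finite B"
  shows "card (supported_in B :: ('b \<Rightarrow> 'a::{zero,finite}) set) = CARD('a) ^ card B"
proof -
  have "bij_betw (\<lambda>f. restrict f B) (supported_in B :: ('b \<Rightarrow> 'a) set) (B \<rightarrow>\<^sub>E UNIV)"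
    by (rule bij_betw_byWitness[where f' = "\<lambda>f x. if x \<in> B then f x else 0"])
      (auto simp: supported_in_def PiE_def extensional_def fun_eq_iff)
  then show ?thesis
    using assms by (simp add: bij_betw_same_card card_PiE)
qed

lemma finite_supported_in:
  assumes "finite B"
  shows "finite (supported_in B :: ('b \<Rightarrow> 'a::{zero,finite}) set)"
  by (rule card_ge_0_finite) (simp add: card_supported_in assms)

section \<open>Boards and rook placements\<close>

text \<open>
  In matrix coordinates \<open>(i', j)\<close> is north and \<open>(i, j')\<close> is east of \<open>(i, j)\<close>. Adding a multiple of row
  \<open>i\<close> to row \<open>i'\<close> in order to clear position \<open>(i', j)\<close> creates new entries only at such corners
  \<open>(i', j')\<close>, provided that \<open>(i, j)\<close> is the leftmost nonzero entry of its row.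
\<close>

definition NE_closed :: "(nat \<times> nat) set \<Rightarrow> bool" where
  "NE_closed B \<longleftrightarrow>
     (\<forall>i i' j j'. (i, j) \<in> B \<longrightarrow> (i', j) \<in> B \<longrightarrow> (i, j') \<in> B \<longrightarrow> i' < i \<longrightarrow> j < j' \<longrightarrow> (i', j') \<in> B)"

lemma NE_closedD:
  "NE_closed B \<Longrightarrow> (i, j) \<in> B \<Longrightarrow> (i', j) \<in> B \<Longrightarrow> (i, j') \<in> B \<Longrightarrow> i' < i \<Longrightarrow> j < j' \<Longrightarrow> (i', j') \<in> B"
  unfolding NE_closed_def by blast

text \<open>
  The corner is inside the outer partition because that one is at least as long in the higher row
  \<open>i'\<close>, and outside the inner partition because it lies east of the position \<open>(i', j)\<close>.
\<close>

lemma NE_closed_skew_shape: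
  assumes "is_skew_shape n S"
  shows "NE_closed S"
proof -
  obtain lam mu where lam: "is_partition n lam"
    and S: "S = straight_shape n lam - straight_shape n mu"
    using assms by (auto simp: is_skew_shape_def)
  have "lam i \<le> lam i'" if "i' < i" "1 \<le> i'" "i \<le> n" for i i'
    using lam that by (simp add: is_partition_def)
  then show ?thesis
    unfolding NE_closed_def S straight_shape_def by fastforce
qed

lemma NE_closed_subgrid:
  assumes "NE_closed B"
  shows "NE_closed {x \<in> B. P (fst x) \<and> Q (snd x)}"
proof -
  have "(i', j') \<in> B \<and> P i' \<and> Q j'"
    if "(i, j) \<in> B" "(i', j) \<in> B \<and> P i'" "(i, j') \<in> B \<and> Q j'" "i' < i" "j < j'" for i i' j j'
    using NE_closedD[OF assms, of i j i' j'] that by blast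
  then show ?thesis
    unfolding NE_closed_def mem_Collect_eq fst_conv snd_conv by blast
qed

definition row_deleted :: "nat \<Rightarrow> (nat \<times> nat) set \<Rightarrow> (nat \<times> nat) set" where
  "row_deleted p B = {x \<in> B. fst x \<noteq> p}"

definition cross_deleted :: "nat \<Rightarrow> nat \<Rightarrow> (nat \<times> nat) set \<Rightarrow> (nat \<times> nat) set" where
  "cross_deleted p j B = {x \<in> B. fst x \<noteq> p \<and> snd x \<noteq> j}"

text \<open>
  For the bottom row \<open>p\<close>, the positions that elimination at the pivot \<open>(p, j)\<close> has to clear.
\<close>

definition hook :: "nat \<Rightarrow> nat \<Rightarrow> (nat \<times> nat) set \<Rightarrow> (nat \<times> nat) set" where
  "hook p j B = {(i, k) \<in> B. i = p \<and> j < k \<or> i < p \<and> k = j}"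

text \<open>
  Among the positions without a rook, these are the ones that \<^const>\<open>inv_NE\<close> omits. Their
  number is the natural statistic for counting matrices: it is the number of entries that can be
  chosen freely once the pivots, at the positions of the rooks, are fixed.
\<close>

definition dominated :: "(nat \<times> nat) set \<Rightarrow> (nat \<times> nat) set \<Rightarrow> (nat \<times> nat) set" where
  "dominated C B =
     {(i, j) \<in> B. (i, j) \<notin> C \<and> ((\<exists>k. (k, j) \<in> C \<and> i < k) \<or> (\<exists>l. (i, l) \<in> C \<and> l < j))}"

definition dominated_sum :: "nat \<Rightarrow> nat \<Rightarrow> (nat \<times> nat) set \<Rightarrow> nat" where
  "dominated_sum q r B = (\<Sum>C | is_rook_placement r B C. q ^ card (dominated C B))"

lemma finite_placements: "finite B \<Longrightarrow> finite {C. is_rook_placement r B C}"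
  by (rule finite_subset[of _ "Pow B"]) (auto simp: is_rook_placement_def)

lemma placements_0: "{C. is_rook_placement 0 B C} = {{}}"
  by (auto simp: is_rook_placement_def)

lemma dominated_sum_0: "dominated_sum q 0 B = 1"
  by (simp add: dominated_sum_def placements_0 dominated_def)

lemma card_board_eq:
  assumes "finite B" "is_rook_placement r B C"
  shows "card B = r + inv_NE C B + card (dominated C B)"
proof -
  let ?N = "{(i, j) \<in> B. (i, j) \<notin> C \<and>
             \<not> (\<exists>k. (k, j) \<in> C \<and> i < k) \<and> \<not> (\<exists>l. (i, l) \<in> C \<and> l < j)}"
  have C: "C \<subseteq> B" "card C = r"
    using assms(2) by (auto simp: is_rook_placement_def)
  have "B = C \<union> ?N \<union> dominated C B"
    using C(1) by (auto simp: dominated_def)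
  then have "card B = card (C \<union> ?N \<union> dominated C B)"
    by simp
  also have "\<dots> = card (C \<union> ?N) + card (dominated C B)"
    by (rule card_Un_disjoint) (use assms(1) C(1) in \<open>auto simp: dominated_def intro: finite_subset\<close>)
  also have "card (C \<union> ?N) = card C + card ?N"
    by (rule card_Un_disjoint) (use assms(1) C(1) in \<open>auto intro: finite_subset\<close>)
  finally show ?thesis
    using C(2) by (simp add: inv_NE_def)
qed

text \<open>
  Sort the placements by the rook in row \<open>p\<close>, if there is one. Since \<open>p\<close> is the bottom row, no rook
  can lie south of a position of row \<open>p\<close>. Hence without a rook in row \<open>p\<close> nothing in that row is
  dominated, and with a rook at \<open>(p, j)\<close> exactly the positions east of it are. The rest of column \<open>j\<close>
  is dominated by that rook, and away from row \<open>p\<close> and column \<open>j\<close> it has no influence.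
\<close>

lemma dominated_sum_Suc:
  assumes fin: "finite B" and bottom: "\<And>i j. (i, j) \<in> B \<Longrightarrow> i \<le> p"
  shows "dominated_sum q (Suc r) B = dominated_sum q (Suc r) (row_deleted p B) +
    (\<Sum>j | (p, j) \<in> B. q ^ card (hook p j B) * dominated_sum q r (cross_deleted p j B))"
proof -
  let ?P = "{C. is_rook_placement (Suc r) B C}"
  let ?Z = "{C. is_rook_placement (Suc r) (row_deleted p B) C}"
  let ?J = "{j. (p, j) \<in> B}"
  let ?Q = "\<lambda>j. {C \<in> ?P. (p, j) \<in> C}"
  let ?w = "\<lambda>C. q ^ card (dominated C B)"
  have finJ: "finite ?J"
    by (rule finite_subset[of _ "snd ` B"]) (auto intro: finite_imageI fin rev_image_eqI)
  have finP: "finite ?P"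
    by (rule finite_placements[OF fin])
  have split: "?P = ?Z \<union> (\<Union>j\<in>?J. ?Q j)"
    by (auto simp: is_rook_placement_def row_deleted_def, blast)
  have dom0: "dominated C B = dominated C (row_deleted p B)" if "C \<in> ?Z" for C
    using that bottom
    by (fastforce simp: is_rook_placement_def row_deleted_def dominated_def)
  have part: "sum ?w (?Q j) = q ^ card (hook p j B) * dominated_sum q r (cross_deleted p j B)"
    if j: "(p, j) \<in> B" for j
  proof -
    let ?R = "{C. is_rook_placement r (cross_deleted p j B) C}"
    have dom: "card (dominated (insert (p, j) C) B) =
        card (hook p j B) + card (dominated C (cross_deleted p j B))" if C: "C \<in> ?R" for C
    proof -
      have sub: "C \<subseteq> cross_deleted p j B"
        using C by (simp add: is_rook_placement_def)
      have "dominated (insert (p, j) C) B = hook p j B \<union> dominated C (cross_deleted p j B)"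
      proof (rule Set.set_eqI)
        fix x :: "nat \<times> nat"
        obtain i k where x: "x = (i, k)"
          by (cases x)
        consider "(i, k) \<notin> B" | "(i, k) \<in> B" "i = p" | "(i, k) \<in> B" "i < p" "k = j"
          | "(i, k) \<in> B" "i < p" "k \<noteq> j"
          using bottom by fastforce
        then have "(i, k) \<in> dominated (insert (p, j) C) B \<longleftrightarrow>
            (i, k) \<in> hook p j B \<union> dominated C (cross_deleted p j B)"
        proof cases
          case 2
          then show ?thesis
            using sub bottom by (fastforce simp: dominated_def hook_def cross_deleted_def)
        qed (use sub in \<open>auto simp: dominated_def hook_def cross_deleted_def\<close>)
        then show "x \<in> dominated (insert (p, j) C) B \<longleftrightarrow>
            x \<in> hook p j B \<union> dominated C (cross_deleted p j B)"
          by (simp only: x)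
      qed
      moreover have "hook p j B \<inter> dominated C (cross_deleted p j B) = {}"
        by (auto simp: dominated_def hook_def cross_deleted_def)
      moreover have "finite (hook p j B)" "finite (dominated C (cross_deleted p j B))"
        by (rule finite_subset[OF _ fin], auto simp: dominated_def hook_def cross_deleted_def)+
      ultimately show ?thesis
        by (simp add: card_Un_disjoint)
    qed
    have "sum ?w (?Q j) =
        (\<Sum>C\<in>?R. q ^ (card (hook p j B) + card (dominated C (cross_deleted p j B))))"
    proof (rule sum.reindex_bij_witness[where i = "insert (p, j)" and j = "\<lambda>C. C - {(p, j)}"])
      fix C assume C: "C \<in> ?Q j"
      show "insert (p, j) (C - {(p, j)}) = C"
        using C by blast
      show R: "C - {(p, j)} \<in> ?R"
      proof -
        have "C - {(p, j)} \<subseteq> cross_deleted p j B"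
          using C by (fastforce simp: is_rook_placement_def cross_deleted_def inj_on_def)
        moreover have "card (C - {(p, j)}) = r"
          using C by (simp add: is_rook_placement_def)
        moreover have "inj_on fst (C - {(p, j)})" "inj_on snd (C - {(p, j)})"
          using C by (auto simp: is_rook_placement_def intro: inj_on_subset)
        ultimately show ?thesis
          using C by (simp add: is_rook_placement_def)
      qed
      show "q ^ (card (hook p j B) + card (dominated (C - {(p, j)}) (cross_deleted p j B))) = ?w C"
        using dom[OF R] C by (simp add: insert_absorb)
    next
      fix C assume C: "C \<in> ?R"
      have new: "(p, j) \<notin> C" "p \<notin> fst ` C" "j \<notin> snd ` C"
        using C by (fastforce simp: is_rook_placement_def cross_deleted_def)+
      show "insert (p, j) C - {(p, j)} = C"
        using new by blast
      show "insert (p, j) C \<in> ?Q j"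
        using C new j by (auto simp: is_rook_placement_def cross_deleted_def)
    qed
    then show ?thesis
      by (simp add: dominated_sum_def power_add sum_distrib_left)
  qed
  have "dominated_sum q (Suc r) B = sum ?w (?Z \<union> (\<Union>j\<in>?J. ?Q j))"
    by (simp only: dominated_sum_def flip: split)
  also have "\<dots> = sum ?w ?Z + sum ?w (\<Union>j\<in>?J. ?Q j)"
  proof (rule sum.union_disjoint)
    have "finite (?Z \<union> (\<Union>j\<in>?J. ?Q j))"
      by (rule back_subst[of finite, OF finP split])
    then show "finite ?Z" "finite (\<Union>j\<in>?J. ?Q j)"
      by simp_all
    show "?Z \<inter> (\<Union>j\<in>?J. ?Q j) = {}"
      by (fastforce simp: is_rook_placement_def row_deleted_def)
  qed
  also have "sum ?w ?Z = dominated_sum q (Suc r) (row_deleted p B)"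
    unfolding dominated_sum_def by (rule sum.cong) (simp_all add: dom0)
  also have "sum ?w (\<Union>j\<in>?J. ?Q j) = (\<Sum>j\<in>?J. sum ?w (?Q j))"
  proof (rule sum.UNION_disjoint)
    show "finite ?J"
      by (rule finJ)
    show "\<forall>j\<in>?J. finite (?Q j)"
      using finP by simp
    show "\<forall>j\<in>?J. \<forall>j'\<in>?J. j \<noteq> j' \<longrightarrow> ?Q j \<inter> ?Q j' = {}"
      by (fastforce simp: is_rook_placement_def inj_on_def)
  qed
  also have "\<dots> =
      (\<Sum>j\<in>?J. q ^ card (hook p j B) * dominated_sum q r (cross_deleted p j B))"
    by (rule sum.cong[OF refl], rule part) simp
  finally show ?thesis .
qed

section \<open>Elimination of the bottom row\<close>

definition arrays_of_rank :: "nat \<Rightarrow> (nat \<times> nat) set \<Rightarrow> nat \<Rightarrow> (nat \<times> nat \<Rightarrow> 'a::field) set" where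
  "arrays_of_rank n B r = {f \<in> supported_in B. array_rank n f = r}"

lemma supported_inD: "f \<in> supported_in B \<Longrightarrow> x \<notin> B \<Longrightarrow> f x = 0"
  by (simp add: supported_in_def)

text \<open>
  Elimination at the pivot \<open>(p, j)\<close> is a bijection onto triples consisting of the pivot value \<open>c\<close>, the
  entries \<open>h\<close> on the hook, and the Schur complement \<open>g\<close>. The corner condition is used in both
  directions: it keeps the Schur complement inside the board, and it keeps inside the board the
  products \<open>h (i, j) * h (p, k) / c\<close> that are added back when the array is reassembled.
\<close>

lemma card_arrays_with_pivot:
  assumes fin: "finite B" and grid: "B \<subseteq> grid n"
    and bottom: "\<And>i j. (i, j) \<in> B \<Longrightarrow> i \<le> p" and NE: "NE_closed B" and pj: "(p, j) \<in> B"
  shows "card {f \<in> arrays_of_rank n B (Suc r).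
      f (p, j) \<noteq> (0 :: 'a::{field,finite}) \<and> (\<forall>l<j. f (p, l) = 0)} =
    (CARD('a) - 1) * CARD('a) ^ card (hook p j B) *
      card (arrays_of_rank n (cross_deleted p j B) r :: (nat \<times> nat \<Rightarrow> 'a) set)"
    (is "card ?M = _")
proof -
  let ?G = "arrays_of_rank n (cross_deleted p j B) r :: (nat \<times> nat \<Rightarrow> 'a) set"
  let ?H = "supported_in (hook p j B) :: (nat \<times> nat \<Rightarrow> 'a) set"
  define schur where "schur = (\<lambda>(f :: nat \<times> nat \<Rightarrow> 'a). \<lambda>(i, k).
    f (i, k) - f (i, j) * f (p, k) / f (p, j))"
  define split where "split = (\<lambda>f :: nat \<times> nat \<Rightarrow> 'a.
    (f (p, j), (\<lambda>x. if x \<in> hook p j B then f x else 0), schur f))"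
  define glue where "glue = (\<lambda>(c :: 'a, h :: nat \<times> nat \<Rightarrow> 'a, g :: nat \<times> nat \<Rightarrow> 'a). \<lambda>(i, k).
    if (i, k) = (p, j) then c
    else if i = p \<or> k = j then h (i, k)
    else g (i, k) + h (i, j) * h (p, k) / c)"
  have pn: "p \<in> {1..n}" "j \<in> {1..n}"
    using grid pj by (auto simp: grid_def)
  have rank: "array_rank n f = Suc (array_rank n (schur f))" if "f (p, j) \<noteq> 0" for f
    unfolding schur_def by (rule array_rank_schur_complement[of p n j f, OF pn that])
  have schur_glue: "schur (glue (c, h, g)) = g" if "c \<noteq> 0" "g \<in> ?G" for c h g
  proof (rule ext, clarify)
    fix i k
    have "g (i, k) = 0" if "i = p \<or> k = j"
      using \<open>g \<in> ?G\<close> that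
      by (auto simp: arrays_of_rank_def cross_deleted_def intro: supported_inD)
    then show "schur (glue (c, h, g)) (i, k) = g (i, k)"
      using \<open>c \<noteq> 0\<close> by (auto simp: schur_def glue_def)
  qed
  have "bij_betw glue ((UNIV - {0 :: 'a}) \<times> ?H \<times> ?G) ?M"
  proof (rule bij_betw_byWitness[where f' = split])
    show "\<forall>a\<in>(UNIV - {0 :: 'a}) \<times> ?H \<times> ?G. split (glue a) = a"
    proof (rule ballI)
      fix a assume "a \<in> (UNIV - {0 :: 'a}) \<times> ?H \<times> ?G"
      then obtain c h g where a: "a = (c, h, g)" and c: "c \<noteq> 0" and h: "h \<in> ?H" and g: "g \<in> ?G"
        by auto
      have "glue (c, h, g) (p, j) = c"
        by (simp add: glue_def)
      moreover have "(\<lambda>x. if x \<in> hook p j B then glue (c, h, g) x else 0) = h"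
        using supported_inD[OF h] by (auto simp: glue_def hook_def)
      ultimately show "split (glue a) = a"
        unfolding a using schur_glue[OF c g] by (simp add: split_def)
    qed
    show "\<forall>f\<in>?M. glue (split f) = f"
    proof (rule ballI)
      fix f assume f: "f \<in> ?M"
      have supp: "(i, k) \<in> B" if "f (i, k) \<noteq> 0" for i k
        using f that by (auto simp: arrays_of_rank_def supported_in_def)
      have hook: "(if (i, k) \<in> hook p j B then f (i, k) else 0) = f (i, k)"
        if "i = p \<or> k = j" "(i, k) \<noteq> (p, j)" for i k
      proof (cases "f (i, k) = 0")
        case False
        then have B: "(i, k) \<in> B"
          by (rule supp)
        have "j < k" if "i = p"
          using f False that \<open>(i, k) \<noteq> (p, j)\<close> by (metis (mono_tags, lifting) linorder_neqE_nat mem_Collect_eq)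
        then have "(i, k) \<in> hook p j B"
          using B bottom[OF B] that by (auto simp: hook_def)
        then show ?thesis by simp
      qed simp
      show "glue (split f) = f"
      proof (rule ext, clarify)
        fix i k
        show "glue (split f) (i, k) = f (i, k)"
          using hook by (simp add: glue_def split_def schur_def)
      qed
    qed
    show "glue ` ((UNIV - {0 :: 'a}) \<times> ?H \<times> ?G) \<subseteq> ?M"
    proof (rule image_subsetI)
      fix a assume "a \<in> (UNIV - {0 :: 'a}) \<times> ?H \<times> ?G"
      then obtain c h g where a: "a = (c, h, g)" and c: "c \<noteq> 0" and h: "h \<in> ?H" and g: "g \<in> ?G"
        by auto
      have pivot: "glue (c, h, g) (p, j) = c"
        by (simp add: glue_def)
      have "array_rank n (glue (c, h, g)) = Suc r"
        using rank[of "glue (c, h, g)"] schur_glue[OF c g] pivot c g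
        by (simp add: arrays_of_rank_def)
      moreover have "glue (c, h, g) \<in> supported_in B"
        unfolding supported_in_def
      proof (clarify)
        fix i k assume ik: "(i, k) \<notin> B"
        have g0: "g (i, k) = 0" 
          using g ik by (auto simp: arrays_of_rank_def cross_deleted_def intro: supported_inD)
        have h0: "h (i, k) = 0"
          using h ik by (auto simp: hook_def intro: supported_inD)
        have "h (i, j) * h (p, k) = 0" if "i \<noteq> p" "k \<noteq> j"
        proof (rule ccontr)
          assume "\<not> ?thesis"
          then have "(i, j) \<in> hook p j B" "(p, k) \<in> hook p j B"
            using h by (auto intro: ccontr supported_inD)
          then have "(i, k) \<in> B"
            using NE_closedD[OF NE pj] that by (auto simp: hook_def)
          then show False using ik by simp
        qed
        then show "glue (c, h, g) (i, k) = 0"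
          using g0 h0 ik pj by (auto simp: glue_def)
      qed
      moreover have "glue (c, h, g) (p, l) = 0" if "l < j" for l
        using h that by (auto simp: glue_def hook_def intro: supported_inD)
      ultimately show "glue a \<in> ?M"
        unfolding a using c pivot by (simp add: arrays_of_rank_def)
    qed
    show "split ` ?M \<subseteq> (UNIV - {0 :: 'a}) \<times> ?H \<times> ?G"
    proof (rule image_subsetI)
      fix f assume f: "f \<in> ?M"
      have supp: "(i, k) \<in> B" if "f (i, k) \<noteq> 0" for i k
        using f that by (auto simp: arrays_of_rank_def supported_in_def)
      have "schur f (i, k) = 0" if ik: "(i, k) \<notin> cross_deleted p j B" for i k
      proof (cases "i = p \<or> k = j")
        case True
        then show ?thesis using f by (auto simp: schur_def)
      next
        case False
        then have nB: "(i, k) \<notin> B"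
          using ik by (simp add: cross_deleted_def)
        have "f (i, j) * f (p, k) = 0"
        proof (rule ccontr)
          assume nz: "\<not> ?thesis"
          then have ij: "(i, j) \<in> B" and pk: "(p, k) \<in> B"
            using supp by auto
          have "\<not> k < j"
            using f nz by auto
          then have "i < p" "j < k"
            using False bottom[OF ij] by auto
          then show False
            using NE_closedD[OF NE pj ij pk] nB by blast
        qed
        moreover have "f (i, k) = 0"
          using supp nB by blast
        ultimately show ?thesis
          by (auto simp: schur_def)
      qed
      then have "schur f \<in> ?G"
        using f rank[of f] by (simp add: arrays_of_rank_def supported_in_def)
      then show "split f \<in> (UNIV - {0 :: 'a}) \<times> ?H \<times> ?G"
        using f by (auto simp: split_def supported_in_def)
    qed
  qed
  moreover have "finite (hook p j B)"
    by (rule finite_subset[OF _ fin]) (auto simp: hook_def)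
  ultimately show ?thesis
    by (simp add: bij_betw_same_card[symmetric] card_cartesian_product card_supported_in
        card_Diff_singleton)
qed

text \<open>
  A nonzero entry can serve as a pivot for a Schur complement, and so forces a positive rank.
\<close>

lemma arrays_of_rank_0:
  assumes "B \<subseteq> grid n"
  shows "arrays_of_rank n B 0 = {\<lambda>_. 0 :: 'a::{field,finite}}"
proof -
  have "f = (\<lambda>_. 0)" if f: "f \<in> arrays_of_rank n B 0" for f :: "nat \<times> nat \<Rightarrow> 'a"
  proof (rule ext, rule ccontr, clarify)
    fix i j assume nz: "f (i, j) \<noteq> 0"
    then have "(i, j) \<in> grid n"
      using f assms by (auto simp: arrays_of_rank_def supported_in_def)
    then show False
      using array_rank_schur_complement[of i n j f] nz f
      by (simp add: arrays_of_rank_def grid_def)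
  qed
  then show ?thesis
    by (auto simp: arrays_of_rank_def supported_in_def array_rank_zero)
qed

lemma finite_arrays_of_rank:
  "finite B \<Longrightarrow> finite (arrays_of_rank n B r :: (nat \<times> nat \<Rightarrow> 'a::{field,finite}) set)"
  by (rule finite_subset[OF _ finite_supported_in]) (auto simp: arrays_of_rank_def)

text \<open>
  Arrays are sorted by the column of the leftmost nonzero entry of the bottom row, if there is one.
\<close>

lemma card_arrays_of_rank_Suc:
  assumes fin: "finite B" and grid: "B \<subseteq> grid n"
    and bottom: "\<And>i j. (i, j) \<in> B \<Longrightarrow> i \<le> p" and NE: "NE_closed B"
  shows "card (arrays_of_rank n B (Suc r) :: (nat \<times> nat \<Rightarrow> 'a::{field,finite}) set) =
    card (arrays_of_rank n (row_deleted p B) (Suc r) :: (nat \<times> nat \<Rightarrow> 'a) set) +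
    (\<Sum>j | (p, j) \<in> B. (CARD('a) - 1) * CARD('a) ^ card (hook p j B) *
      card (arrays_of_rank n (cross_deleted p j B) r :: (nat \<times> nat \<Rightarrow> 'a) set))"
proof -
  let ?M = "arrays_of_rank n B (Suc r) :: (nat \<times> nat \<Rightarrow> 'a) set"
  let ?Z = "arrays_of_rank n (row_deleted p B) (Suc r) :: (nat \<times> nat \<Rightarrow> 'a) set"
  let ?J = "{j. (p, j) \<in> B}"
  let ?N = "\<lambda>j. {f \<in> ?M. f (p, j) \<noteq> 0 \<and> (\<forall>l<j. f (p, l) = 0)}"
  have finJ: "finite ?J"
    by (rule finite_subset[of _ "snd ` B"]) (auto intro: finite_imageI fin rev_image_eqI)
  have finM: "finite ?M"
    by (rule finite_arrays_of_rank[OF fin])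
  have "?M \<subseteq> ?Z \<union> (\<Union>j\<in>?J. ?N j)"
  proof
    fix f assume f: "f \<in> ?M"
    show "f \<in> ?Z \<union> (\<Union>j\<in>?J. ?N j)"
    proof (cases "\<exists>j. f (p, j) \<noteq> 0")
      case True
      define j where "j = (LEAST j. f (p, j) \<noteq> 0)"
      have "f (p, j) \<noteq> 0"
        unfolding j_def by (rule LeastI_ex[OF True])
      moreover have "f (p, l) = 0" if "l < j" for l
        using not_less_Least that unfolding j_def by blast
      moreover have "(p, j) \<in> B"
        using f \<open>f (p, j) \<noteq> 0\<close> by (auto simp: arrays_of_rank_def supported_in_def)
      ultimately show ?thesis
        using f by blast
    next
      case False
      then have "f \<in> ?Z"
        using f by (auto simp: arrays_of_rank_def supported_in_def row_deleted_def)
      then show ?thesis ..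
    qed
  qed
  moreover have "?Z \<subseteq> ?M"
    by (auto simp: arrays_of_rank_def supported_in_def row_deleted_def)
  ultimately have "?M = ?Z \<union> (\<Union>j\<in>?J. ?N j)"
    by blast
  then have "card ?M = card (?Z \<union> (\<Union>j\<in>?J. ?N j))"
    by (rule arg_cong)
  also have "\<dots> = card ?Z + card (\<Union>j\<in>?J. ?N j)"
  proof (rule card_Un_disjoint)
    show "finite ?Z"
      by (rule finite_subset[OF \<open>?Z \<subseteq> ?M\<close> finM])
    show "finite (\<Union>j\<in>?J. ?N j)"
      by (rule finite_subset[OF _ finM]) blast
    have "f (p, j) = 0" if "f \<in> ?Z" for f j
      using that by (simp add: arrays_of_rank_def supported_in_def row_deleted_def)
    then show "?Z \<inter> (\<Union>j\<in>?J. ?N j) = {}"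
      by blast
  qed
  also have "card (\<Union>j\<in>?J. ?N j) = (\<Sum>j\<in>?J. card (?N j))"
  proof (rule card_UN_disjoint)
    show "finite ?J"
      by (rule finJ)
    show "\<forall>j\<in>?J. finite (?N j)"
      using finM by simp
    show "\<forall>j\<in>?J. \<forall>j'\<in>?J. j \<noteq> j' \<longrightarrow> ?N j \<inter> ?N j' = {}"
    proof (intro ballI impI equals0I)
      fix j j' f assume "j \<noteq> j'" "f \<in> ?N j \<inter> ?N j'"
      then show False
        by (cases j j' rule: linorder_cases) auto
    qed
  qed
  also have "\<dots> = (\<Sum>j\<in>?J. (CARD('a) - 1) * CARD('a) ^ card (hook p j B) *
      card (arrays_of_rank n (cross_deleted p j B) r :: (nat \<times> nat \<Rightarrow> 'a) set))"
    by (rule sum.cong) (use card_arrays_with_pivot[OF fin grid bottom NE] in auto)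
  finally show ?thesis .
qed

text \<open>
  Both sides satisfy the same recursion in the bottom row. The induction is on a bound \<open>p\<close> for the
  rows that meet the board, with \<open>n\<close> fixed, so all arrays stay of size \<open>n\<close>.
\<close>

lemma card_arrays_of_rank:
  assumes "B \<subseteq> grid n" "NE_closed B"
  shows "card (arrays_of_rank n B r :: (nat \<times> nat \<Rightarrow> 'a::{field,finite}) set) =
    (CARD('a) - 1) ^ r * dominated_sum CARD('a) r B"
proof -
  have main: "card (arrays_of_rank n B r :: (nat \<times> nat \<Rightarrow> 'a) set) =
      (CARD('a) - 1) ^ r * dominated_sum CARD('a) r B"
    if "B \<subseteq> grid n" "NE_closed B" "\<And>i j. (i, j) \<in> B \<Longrightarrow> i \<le> p" for p
    using that
  proof (induction p arbitrary: B r)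
    case 0
    then have B: "B = {}"
      by (fastforce simp: grid_def)
    show ?case
    proof (cases r)
      case 0
      then show ?thesis
        using arrays_of_rank_0[of B n, where 'a = 'a] B by (simp add: dominated_sum_0)
    next
      case (Suc r')
      have "(arrays_of_rank n B (Suc r') :: (nat \<times> nat \<Rightarrow> 'a) set) = {}"
      proof (rule equals0I)
        fix f :: "nat \<times> nat \<Rightarrow> 'a" assume f: "f \<in> arrays_of_rank n B (Suc r')"
        then have "f = (\<lambda>_. 0)"
          using B by (auto simp: arrays_of_rank_def supported_in_def)
        then show False
          using f by (simp add: arrays_of_rank_def array_rank_zero)
      qed
      moreover have "{C. is_rook_placement (Suc r') B C} = {}"
        using B by (auto simp: is_rook_placement_def)
      ultimately show ?thesis
        using Suc by (simp add: dominated_sum_def)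
    qed
  next
    case (Suc p)
    have fin: "finite B"
      by (rule finite_subset[OF Suc.prems(1)]) (simp add: grid_def)
    show ?case
    proof (cases r)
      case 0
      then show ?thesis
        using arrays_of_rank_0[OF Suc.prems(1), where 'a = 'a] by (simp add: dominated_sum_0)
    next
      case (Suc r')
      let ?q = "CARD('a)"
      have "card (arrays_of_rank n (row_deleted (Suc p) B) r :: (nat \<times> nat \<Rightarrow> 'a) set) =
          (?q - 1) ^ r * dominated_sum ?q r (row_deleted (Suc p) B)"
      proof (rule Suc.IH)
        show "row_deleted (Suc p) B \<subseteq> grid n"
          using Suc.prems(1) by (auto simp: row_deleted_def)
        show "NE_closed (row_deleted (Suc p) B)"
          using NE_closed_subgrid[OF Suc.prems(2), of "\<lambda>i. i \<noteq> Suc p" "\<lambda>_. True"]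
          by (simp add: row_deleted_def)
        show "i \<le> p" if "(i, j) \<in> row_deleted (Suc p) B" for i j
          using that Suc.prems(3)[of i j] by (simp add: row_deleted_def)
      qed
      moreover have "card (arrays_of_rank n (cross_deleted (Suc p) j B) r' :: (nat \<times> nat \<Rightarrow> 'a) set) =
          (?q - 1) ^ r' * dominated_sum ?q r' (cross_deleted (Suc p) j B)" for j
      proof (rule Suc.IH)
        show "cross_deleted (Suc p) j B \<subseteq> grid n"
          using Suc.prems(1) by (auto simp: cross_deleted_def)
        show "NE_closed (cross_deleted (Suc p) j B)"
          using NE_closed_subgrid[OF Suc.prems(2), of "\<lambda>i. i \<noteq> Suc p" "\<lambda>k. k \<noteq> j"]
          by (simp add: cross_deleted_def)
        show "i \<le> p" if "(i, k) \<in> cross_deleted (Suc p) j B" for i k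
          using that Suc.prems(3)[of i k] by (simp add: cross_deleted_def)
      qed
      ultimately show ?thesis
        unfolding \<open>r = Suc r'\<close>
        using card_arrays_of_rank_Suc[OF fin Suc.prems(1) Suc.prems(3) Suc.prems(2), where r = r' and 'a = 'a]
          dominated_sum_Suc[OF fin Suc.prems(3), where q = ?q and r = r']
        by (simp add: algebra_simps sum_distrib_left)
    qed
  qed
  show ?thesis
    by (rule main[OF assms, of n]) (use assms(1) in \<open>auto simp: grid_def\<close>)
qed

section \<open>From the Rothe diagram to the skew shape\<close>

lemma mat_count_eq_card_arrays:
  "mat_count TYPE('a::{field,finite}) n R r =
    card (arrays_of_rank n (grid n - R) r :: (nat \<times> nat \<Rightarrow> 'a) set)"
  if "R \<subseteq> grid n"
proof -
  let ?F = "arrays_of_rank n (grid n - R) r :: (nat \<times> nat \<Rightarrow> 'a) set"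
  let ?from = "\<lambda>A (i, j). if (i, j) \<in> grid n then A $$ (i - 1, j - 1) else 0 :: 'a"
  let ?M = "{A :: 'a mat. A \<in> carrier_mat n n \<and> vec_space.rank n A = r \<and>
             (\<forall>(i, j)\<in>R. A $$ (i - 1, j - 1) = 0)}"
  have to_from: "array_mat n (?from A) = A" if "A \<in> carrier_mat n n" for A
    using that by (auto simp: array_mat_def grid_def)
  have entry: "array_mat n f $$ (i - 1, j - 1) = f (i, j)"
    if "(i, j) \<in> grid n" for f :: "nat \<times> nat \<Rightarrow> 'a" and i j
    using that by (auto simp: array_mat_def grid_def)
  have "bij_betw (array_mat n) ?F ?M"
  proof (rule bij_betw_byWitness[where f' = ?from])
    show "\<forall>f\<in>?F. ?from (array_mat n f) = f"
      using entry by (auto simp: arrays_of_rank_def supported_in_def fun_eq_iff)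
    show "\<forall>A\<in>?M. array_mat n (?from A) = A"
      using to_from by blast
    show "array_mat n ` ?F \<subseteq> ?M"
    proof (rule image_subsetI)
      fix f assume f: "f \<in> ?F"
      have "array_mat n f $$ (i - 1, j - 1) = 0" if "(i, j) \<in> R" for i j
        using f that entry[of i j f] \<open>R \<subseteq> grid n\<close>
        by (auto simp: arrays_of_rank_def supported_in_def)
      then show "array_mat n f \<in> ?M"
        using f by (auto simp: arrays_of_rank_def)
    qed
    show "?from ` ?M \<subseteq> ?F"
    proof (rule image_subsetI)
      fix A assume A: "A \<in> ?M"
      then have "array_rank n (?from A) = r"
        using to_from by simp
      moreover have "?from A \<in> supported_in (grid n - R)"
        using A by (auto simp: supported_in_def)
      ultimately show "?from A \<in> ?F"
        by (simp add: arrays_of_rank_def)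
    qed
  qed
  then show ?thesis
    by (simp add: mat_count_def bij_betw_same_card)
qed

lemma card_arrays_permute:
  assumes s: "s permutes {1..n}" and t: "t permutes {1..n}"
    and S: "S \<subseteq> grid n" and T: "T \<subseteq> grid n"
    and iff: "\<And>i j. (i, j) \<in> grid n \<Longrightarrow> (s i, t j) \<in> S \<longleftrightarrow> (i, j) \<in> T"
  shows "card (arrays_of_rank n T r :: (nat \<times> nat \<Rightarrow> 'a::{field,finite}) set) =
    card (arrays_of_rank n S r :: (nat \<times> nat \<Rightarrow> 'a) set)"
proof -
  let ?s' = "Hilbert_Choice.inv s" and ?t' = "Hilbert_Choice.inv t"
  let ?to = "\<lambda>(f :: nat \<times> nat \<Rightarrow> 'a) (i, j). f (s i, t j)"
  let ?from = "\<lambda>(f :: nat \<times> nat \<Rightarrow> 'a) (i, j). f (?s' i, ?t' j)"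
  have inverse: "s (?s' i) = i" "t (?t' i) = i" "?s' (s i) = i" "?t' (t i) = i" for i
    using permutes_inverses[OF s] permutes_inverses[OF t] by auto
  have iff': "(s i, t j) \<in> S \<longleftrightarrow> (i, j) \<in> T" for i j
    using iff[of i j] S T permutes_in_image[OF s, of i] permutes_in_image[OF t, of j]
    by (auto simp: grid_def)
  then have iff'': "(?s' i, ?t' j) \<in> T \<longleftrightarrow> (i, j) \<in> S" for i j
    using iff'[of "?s' i" "?t' j"] by (simp add: inverse)
  have "bij_betw ?to (arrays_of_rank n S r) (arrays_of_rank n T r)"
  proof (rule bij_betw_byWitness[where f' = ?from])
    show "?to ` arrays_of_rank n S r \<subseteq> arrays_of_rank n T r"
      using array_rank_permute[OF s t] iff'
      by (auto simp: arrays_of_rank_def supported_in_def)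
    show "?from ` arrays_of_rank n T r \<subseteq> arrays_of_rank n S r"
      using array_rank_permute[OF permutes_inv[OF s] permutes_inv[OF t]] iff''
      by (auto simp: arrays_of_rank_def supported_in_def)
  qed (auto simp: inverse)
  then show ?thesis
    by (simp add: bij_betw_same_card)
qed

lemma card_rothe_diagram:
  assumes w: "w permutes {1..n}"
  shows "card (rothe_diagram n w) = num_inversions n w"
proof -
  let ?I = "{(i, j). i \<in> {1..n} \<and> j \<in> {1..n} \<and> i < j \<and> w i > w j}"
  have range: "w i \<in> {1..n}" "Hilbert_Choice.inv w i \<in> {1..n}" if "i \<in> {1..n}" for i
    using that permutes_in_image[OF w] permutes_in_image[OF permutes_inv[OF w]] by auto
  have inverse: "w (Hilbert_Choice.inv w i) = i" "Hilbert_Choice.inv w (w i) = i" for i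
    using permutes_inverses[OF w] by auto
  have "bij_betw (\<lambda>(i, j). (i, w j)) ?I (rothe_diagram n w)"
  proof (rule bij_betw_byWitness[where f' = "\<lambda>(i, j). (i, Hilbert_Choice.inv w j)"])
    show "(\<lambda>(i, j). (i, w j)) ` ?I \<subseteq> rothe_diagram n w"
      using range(1) by (auto simp: rothe_diagram_def grid_def inverse simp del: atLeastAtMost_iff)
    show "(\<lambda>(i, j). (i, Hilbert_Choice.inv w j)) ` rothe_diagram n w \<subseteq> ?I"
      using range(2) by (auto simp: rothe_diagram_def grid_def inverse simp del: atLeastAtMost_iff)
  qed (simp_all add: inverse split_beta)
  then show ?thesis
    by (simp add: num_inversions_def bij_betw_same_card)
qed

section \<open>The rook polynomial\<close>

text \<open>
  Replacing \<open>q\<close> by its inverse turns the count of undominated positions into the complementary count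
  of dominated ones, up to the global power of \<open>q\<close>.
\<close>

lemma rook_poly_NE_inverse:
  assumes fin: "finite B" and q: "q > 0"
  shows "real q powi (int (card B) - int r) * rook_poly_NE r B (inverse (real q)) =
    real (dominated_sum q r B)"
proof -
  have "real q powi (int (card B) - int r) * inverse (real q) ^ inv_NE C B =
      real (q ^ card (dominated C B))" if C: "is_rook_placement r B C" for C
  proof -
    have "int (card B) - int r = int (inv_NE C B + card (dominated C B))"
      using card_board_eq[OF fin C] by simp
    then have "real q powi (int (card B) - int r) =
        real q ^ inv_NE C B * real q ^ card (dominated C B)"
      by (simp only: power_int_of_nat power_add)
    then show ?thesis
      using q by (simp add: power_inverse)
  qed
  then show ?thesis
    by (simp add: rook_poly_NE_def dominated_sum_def sum_distrib_left)
qed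

theorem corollary5p5:
  fixes n r :: nat and w :: "nat \<Rightarrow> nat" and S :: "(nat \<times> nat) set"
  assumes "w permutes {1..n}"
    and "skew_vexillary n w"
    and "S \<subseteq> grid n"
    and "skew_shape_of_perm n w S"
    and "r \<le> n"
  shows "\<exists>P :: int poly. (\<forall>k. coeff P k \<ge> 0) \<and>
    (\<forall>q :: nat. primepow q \<longrightarrow>
       real q powi (int (n\<^sup>2) - int (num_inversions n w) - int r) * rook_poly_NE r S (inverse (real q))
         = real_of_int (poly P (int q)) \<and>
       (CARD('a) = q \<longrightarrow>
          real (mat_count TYPE('a::{field,finite}) n (rothe_diagram n w) r) / (real q - 1) ^ r
            = real q powi (int (n\<^sup>2) - int (num_inversions n w) - int r)
                * rook_poly_NE r S (inverse (real q))))"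
proof -
  define R where "R = rothe_diagram n w"
  have R: "R \<subseteq> grid n"
    by (auto simp: R_def rothe_diagram_def)
  have fin_grid: "finite (grid n)"
    by (simp add: grid_def)
  then have finS: "finite S"
    using assms(3) finite_subset by blast
  obtain s t where s: "s permutes {1..n}" and t: "t permutes {1..n}"
    and st: "{(s i, t j) | i j. (i, j) \<in> R} = grid n - S"
    using assms(4) by (auto simp: skew_shape_of_perm_def R_def)
  have inj: "inj (map_prod s t)"
    using permutes_inj[OF s] permutes_inj[OF t] by (simp add: prod.inj_map)
  have img: "map_prod s t ` R = grid n - S"
    unfolding st[symmetric] by force
  have iff: "(s i, t j) \<in> S \<longleftrightarrow> (i, j) \<in> grid n - R" if "(i, j) \<in> grid n" for i j
  proof -
    have "(s i, t j) \<in> grid n"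
      using that permutes_in_image[OF s] permutes_in_image[OF t] by (simp add: grid_def)
    moreover have "(s i, t j) \<in> map_prod s t ` R \<longleftrightarrow> (i, j) \<in> R"
      using inj_image_mem_iff[OF inj, of "(i, j)" R] by simp
    ultimately show ?thesis
      using that unfolding img by blast
  qed
  have "num_inversions n w = card (grid n - S)"
    using card_image[OF inj_on_subset[OF inj subset_UNIV], of R] card_rothe_diagram[OF assms(1)]
    by (simp add: R_def flip: img)
  then have "num_inversions n w + card S = n\<^sup>2"
    using card_Diff_subset[OF finS assms(3)] card_mono[OF fin_grid assms(3)]
    by (simp add: grid_def power2_eq_square)
  then have expo: "int (n\<^sup>2) - int (num_inversions n w) - int r = int (card S) - int r"
    by linarith
  define P :: "int poly" where
    "P = (\<Sum>C | is_rook_placement r S C. monom 1 (card (dominated C S)))"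
  have "coeff P k \<ge> 0" for k
    by (auto simp: P_def coeff_sum intro: sum_nonneg)
  moreover have value_eq: "real q powi (int (n\<^sup>2) - int (num_inversions n w) - int r) *
      rook_poly_NE r S (inverse (real q)) = real (dominated_sum q r S)" if "primepow q" for q
    unfolding expo using primepow_gt_0_nat[OF that] by (rule rook_poly_NE_inverse[OF finS])
  moreover have "real_of_int (poly P (int q)) = real (dominated_sum q r S)" for q
    by (simp add: P_def poly_sum poly_monom dominated_sum_def)
  moreover have "real (mat_count TYPE('a) n (rothe_diagram n w) r) / (real q - 1) ^ r =
      real (dominated_sum q r S)" if "CARD('a) = q" for q
  proof -
    have "NE_closed S"
      using assms(4) by (auto simp: skew_shape_of_perm_def intro: NE_closed_skew_shape)
    have "mat_count TYPE('a) n R r = card (arrays_of_rank n S r :: (nat \<times> nat \<Rightarrow> 'a) set)"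
      unfolding mat_count_eq_card_arrays[OF R]
      by (rule card_arrays_permute[OF s t assms(3) _ iff]) auto
    also have "\<dots> = (q - 1) ^ r * dominated_sum q r S"
      using card_arrays_of_rank[OF assms(3) \<open>NE_closed S\<close>, where 'a = 'a] that by simp
    finally show ?thesis
      using two_le_card_field[where 'a = 'a] that by (simp add: R_def of_nat_diff)
  qed
  ultimately show ?thesis
    by (intro exI[of _ P]) auto
qed

end
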